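(* Let $R$ be a ring. If every simple-direct-projective right $R$-module is simple-direct-injective, then $R$ is a right max-ring.
   Context: Rings are associative with unity and modules are unitary. A right module $M$ is simple-direct-injective if, whenever $A$ and $B$ are simple submodules of $M$ with $A\cong B$ and $B$ a direct summand of $M$, then $A$ is a direct summand of $M$. A right module $M$ is simple-direct-projective if, whenever $A$ and $B$ are submodules of $M$ with $B$ simple, $M/A\cong B$ and $B$ a direct summand of $M$, then $A$ is a direct summand of $M$. $R$ is a right max-ring if every nonzero right $R$-module has a maximal submodule. *)

theory Defs
  imports "HOL-Algebra.AbelCoset"
begin

text \<open>
  HOL-Algebra only has modules over commutative rings, so right modules over an arbitrary
  (associative, unital) ring are introduced here. As for the library's module record, the fields
  \<open>mult\<close> and \<open>one\<close> inherited from \<open>ring\<close> carry no meaning.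
\<close>

record ('a, 'm) rmodule = "'m ring" +
  rsmult :: "'m \<Rightarrow> 'a \<Rightarrow> 'm"  (infixl \<open>\<cdot>\<index>\<close> 70)

locale right_module = R?: ring R + M?: abelian_group M
  for R :: "('a, 'r) ring_scheme" (structure)
    and M :: "('a, 'm, 'k) rmodule_scheme" (structure) +
  assumes rsmult_closed [simp, intro]:
      "\<lbrakk>x \<in> carrier M; a \<in> carrier R\<rbrakk> \<Longrightarrow> x \<cdot>\<^bsub>M\<^esub> a \<in> carrier M"
    and rsmult_add_ring:
      "\<lbrakk>x \<in> carrier M; a \<in> carrier R; b \<in> carrier R\<rbrakk> \<Longrightarrow>
        x \<cdot>\<^bsub>M\<^esub> (a \<oplus>\<^bsub>R\<^esub> b) = x \<cdot>\<^bsub>M\<^esub> a \<oplus>\<^bsub>M\<^esub> x \<cdot>\<^bsub>M\<^esub> b"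
    and rsmult_add_module:
      "\<lbrakk>x \<in> carrier M; y \<in> carrier M; a \<in> carrier R\<rbrakk> \<Longrightarrow>
        (x \<oplus>\<^bsub>M\<^esub> y) \<cdot>\<^bsub>M\<^esub> a = x \<cdot>\<^bsub>M\<^esub> a \<oplus>\<^bsub>M\<^esub> y \<cdot>\<^bsub>M\<^esub> a"
    and rsmult_assoc:
      "\<lbrakk>x \<in> carrier M; a \<in> carrier R; b \<in> carrier R\<rbrakk> \<Longrightarrow>
        x \<cdot>\<^bsub>M\<^esub> (a \<otimes>\<^bsub>R\<^esub> b) = (x \<cdot>\<^bsub>M\<^esub> a) \<cdot>\<^bsub>M\<^esub> b"
    and rsmult_one [simp]:
      "x \<in> carrier M \<Longrightarrow> x \<cdot>\<^bsub>M\<^esub> \<one>\<^bsub>R\<^esub> = x"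

locale right_submodule = additive_subgroup A M
  for A :: "'m set" and R :: "('a, 'r) ring_scheme"
    and M :: "('a, 'm, 'k) rmodule_scheme" (structure) +
  assumes rsmult_mem:
      "\<lbrakk>x \<in> A; a \<in> carrier R\<rbrakk> \<Longrightarrow> x \<cdot>\<^bsub>M\<^esub> a \<in> A"

text \<open>A submodule \<open>A\<close> of \<open>M\<close> is viewed as a module in its own right as \<open>M\<lparr>carrier := A\<rparr>\<close>.\<close>

lemma (in right_module) right_submodule_is_right_module:
  assumes "right_submodule A R M"
  shows "right_module R (M\<lparr>carrier := A\<rparr>)"
proof -
  interpret A: right_submodule A R M by fact
  have sub: "x \<in> carrier M" if "x \<in> A" for x using A.a_subset that by blast
  have inv: "\<exists>y\<in>A. y \<oplus>\<^bsub>M\<^esub> x = \<zero>\<^bsub>M\<^esub>" if "x \<in> A" for x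
    using A.a_inv_closed[OF that] sub[OF that] M.l_neg by blast
  have "abelian_group (M\<lparr>carrier := A\<rparr>)"
    by (rule abelian_groupI)
      (use inv sub in \<open>simp_all add: M.a_ac\<close>)
  then show ?thesis
    by (intro right_module.intro right_module_axioms.intro R.ring_axioms)
      (use sub in \<open>simp_all add: A.rsmult_mem rsmult_add_ring rsmult_add_module rsmult_assoc\<close>)
qed

definition quotient_rmodule ::
    "('a, 'm, 'k) rmodule_scheme \<Rightarrow> 'm set \<Rightarrow> ('a, 'm set) rmodule"
  where "quotient_rmodule M A =
    \<lparr>carrier = a_rcosets\<^bsub>M\<^esub> A, mult = undefined, one = undefined,
     zero = A, add = set_add M,
     rsmult = (\<lambda>X a. \<Union>x\<in>X. A +>\<^bsub>M\<^esub> (x \<cdot>\<^bsub>M\<^esub> a))\<rparr>"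

lemma (in right_module) quotient_rsmult_coset:
  assumes "right_submodule A R M" "x \<in> carrier M" "a \<in> carrier R"
  shows "(A +>\<^bsub>M\<^esub> x) \<cdot>\<^bsub>quotient_rmodule M A\<^esub> a = A +>\<^bsub>M\<^esub> (x \<cdot>\<^bsub>M\<^esub> a)"
proof -
  interpret A: right_submodule A R M by fact
  interpret A: abelian_subgroup A M
    by (rule abelian_subgroupI3[OF A.additive_subgroup_axioms M.abelian_group_axioms])
  have sub: "z \<in> carrier M" if "z \<in> A" for z using A.a_subset that by blast
  have eq: "A +>\<^bsub>M\<^esub> (y \<cdot>\<^bsub>M\<^esub> a) = A +>\<^bsub>M\<^esub> (x \<cdot>\<^bsub>M\<^esub> a)" if y: "y \<in> A +>\<^bsub>M\<^esub> x" for y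
  proof -
    obtain h where h: "h \<in> A" "y = h \<oplus>\<^bsub>M\<^esub> x"
      using y unfolding a_r_coset_def' by blast
    have "y \<cdot>\<^bsub>M\<^esub> a = h \<cdot>\<^bsub>M\<^esub> a \<oplus>\<^bsub>M\<^esub> x \<cdot>\<^bsub>M\<^esub> a"
      unfolding h(2) by (rule rsmult_add_module[OF sub[OF h(1)] assms(2,3)])
    then have "y \<cdot>\<^bsub>M\<^esub> a \<in> A +>\<^bsub>M\<^esub> (x \<cdot>\<^bsub>M\<^esub> a)"
      unfolding a_r_coset_def' using A.rsmult_mem[OF h(1) assms(3)] by blast
    from A.a_repr_independence'[OF this rsmult_closed[OF assms(2,3)]]
    show ?thesis by (rule sym)
  qed
  have "x \<in> A +>\<^bsub>M\<^esub> x" using assms(2) by (rule A.a_rcos_self)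
  then have "(\<Union>y\<in>A +>\<^bsub>M\<^esub> x. A +>\<^bsub>M\<^esub> (y \<cdot>\<^bsub>M\<^esub> a)) = A +>\<^bsub>M\<^esub> (x \<cdot>\<^bsub>M\<^esub> a)"
    by (intro SUP_eq_const eq) auto
  then show ?thesis
    unfolding quotient_rmodule_def rmodule.simps .
qed

lemma (in right_module) quotient_is_right_module:
  assumes "right_submodule A R M"
  shows "right_module R (quotient_rmodule M A)"
proof -
  interpret A: right_submodule A R M by fact
  interpret A: abelian_subgroup A M
    by (rule abelian_subgroupI3[OF A.additive_subgroup_axioms M.abelian_group_axioms])
  let ?Q = "quotient_rmodule M A"
  have car: "X \<in> carrier ?Q \<longleftrightarrow> (\<exists>x\<in>carrier M. X = A +>\<^bsub>M\<^esub> x)" for X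
    by (auto simp: quotient_rmodule_def A_RCOSETS_def')
  have add: "(A +>\<^bsub>M\<^esub> x) \<oplus>\<^bsub>?Q\<^esub> (A +>\<^bsub>M\<^esub> y) = A +>\<^bsub>M\<^esub> (x \<oplus>\<^bsub>M\<^esub> y)"
    if "x \<in> carrier M" "y \<in> carrier M" for x y
    using A.a_rcos_sum that by (simp add: quotient_rmodule_def)
  have zero: "\<zero>\<^bsub>?Q\<^esub> = A +>\<^bsub>M\<^esub> \<zero>\<^bsub>M\<^esub>"
    using A.a_subset by (simp add: quotient_rmodule_def M.a_coset_add_zero)
  have "abelian_group ?Q"
  proof (rule abelian_groupI)
    fix X Y assume "X \<in> carrier ?Q" "Y \<in> carrier ?Q"
    then obtain x y where xy: "x \<in> carrier M" "X = A +>\<^bsub>M\<^esub> x" "y \<in> carrier M" "Y = A +>\<^bsub>M\<^esub> y"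
      by (auto simp: car)
    show "X \<oplus>\<^bsub>?Q\<^esub> Y \<in> carrier ?Q"
      unfolding xy add[OF xy(1,3)] car using xy(1,3) by blast
    show "X \<oplus>\<^bsub>?Q\<^esub> Y = Y \<oplus>\<^bsub>?Q\<^esub> X"
      unfolding xy add[OF xy(1,3)] add[OF xy(3,1)] using M.a_comm[OF xy(1,3)] by simp
    fix Z assume "Z \<in> carrier ?Q"
    then obtain z where z: "z \<in> carrier M" "Z = A +>\<^bsub>M\<^esub> z" by (auto simp: car)
    show "X \<oplus>\<^bsub>?Q\<^esub> Y \<oplus>\<^bsub>?Q\<^esub> Z = X \<oplus>\<^bsub>?Q\<^esub> (Y \<oplus>\<^bsub>?Q\<^esub> Z)"
      by (simp add: xy z add M.a_assoc)
  next
    show "\<zero>\<^bsub>?Q\<^esub> \<in> carrier ?Q"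
      unfolding zero car by blast
  next
    fix X assume "X \<in> carrier ?Q"
    then obtain x where x: "x \<in> carrier M" "X = A +>\<^bsub>M\<^esub> x" by (auto simp: car)
    then show "\<zero>\<^bsub>?Q\<^esub> \<oplus>\<^bsub>?Q\<^esub> X = X" by (simp add: add zero)
    have "(A +>\<^bsub>M\<^esub> (\<ominus>\<^bsub>M\<^esub> x)) \<oplus>\<^bsub>?Q\<^esub> X = \<zero>\<^bsub>?Q\<^esub>"
      by (simp add: x add zero M.l_neg)
    moreover have "A +>\<^bsub>M\<^esub> (\<ominus>\<^bsub>M\<^esub> x) \<in> carrier ?Q"
      unfolding car using M.a_inv_closed[OF x(1)] by blast
    ultimately show "\<exists>Y\<in>carrier ?Q. Y \<oplus>\<^bsub>?Q\<^esub> X = \<zero>\<^bsub>?Q\<^esub>" by blast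
  qed
  moreover have "right_module_axioms R ?Q"
  proof (rule right_module_axioms.intro)
    fix X a assume "X \<in> carrier ?Q" and a: "a \<in> carrier R"
    then obtain x where x: "x \<in> carrier M" "X = A +>\<^bsub>M\<^esub> x" by (auto simp: car)
    note smult = quotient_rsmult_coset[OF assms]
    show "X \<cdot>\<^bsub>?Q\<^esub> a \<in> carrier ?Q"
      unfolding x smult[OF x(1) a] car by (rule bexI[OF _ rsmult_closed[OF x(1) a]]) (rule refl)
    fix b assume b: "b \<in> carrier R"
    show "X \<cdot>\<^bsub>?Q\<^esub> (a \<oplus>\<^bsub>R\<^esub> b) = X \<cdot>\<^bsub>?Q\<^esub> a \<oplus>\<^bsub>?Q\<^esub> X \<cdot>\<^bsub>?Q\<^esub> b"
      by (simp add: x a b smult add rsmult_add_ring)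
    show "X \<cdot>\<^bsub>?Q\<^esub> (a \<otimes>\<^bsub>R\<^esub> b) = (X \<cdot>\<^bsub>?Q\<^esub> a) \<cdot>\<^bsub>?Q\<^esub> b"
      by (simp add: x a b smult rsmult_assoc)
  next
    fix X Y a assume "X \<in> carrier ?Q" "Y \<in> carrier ?Q" and a: "a \<in> carrier R"
    then obtain x y where "x \<in> carrier M" "X = A +>\<^bsub>M\<^esub> x" "y \<in> carrier M" "Y = A +>\<^bsub>M\<^esub> y"
      by (auto simp: car)
    then show "(X \<oplus>\<^bsub>?Q\<^esub> Y) \<cdot>\<^bsub>?Q\<^esub> a = X \<cdot>\<^bsub>?Q\<^esub> a \<oplus>\<^bsub>?Q\<^esub> Y \<cdot>\<^bsub>?Q\<^esub> a"
      using a by (simp add: quotient_rsmult_coset[OF assms] add rsmult_add_module)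
  next
    fix X assume "X \<in> carrier ?Q"
    then show "X \<cdot>\<^bsub>?Q\<^esub> \<one>\<^bsub>R\<^esub> = X"
      by (auto simp: car quotient_rsmult_coset[OF assms])
  qed
  ultimately show ?thesis
    by (intro right_module.intro R.ring_axioms)
qed

definition rmodule_hom ::
    "('a, 'r) ring_scheme \<Rightarrow> ('a, 'm, 'k) rmodule_scheme \<Rightarrow> ('a, 'n, 'l) rmodule_scheme
      \<Rightarrow> ('m \<Rightarrow> 'n) set"
  where "rmodule_hom R M N =
    {f \<in> hom (add_monoid M) (add_monoid N).
      \<forall>x\<in>carrier M. \<forall>a\<in>carrier R. f (x \<cdot>\<^bsub>M\<^esub> a) = f x \<cdot>\<^bsub>N\<^esub> a}"

definition rmodule_isomorphic ::
    "('a, 'r) ring_scheme \<Rightarrow> ('a, 'm, 'k) rmodule_scheme \<Rightarrow> ('a, 'n, 'l) rmodule_scheme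
      \<Rightarrow> bool"
  where "rmodule_isomorphic R M N \<longleftrightarrow>
    (\<exists>f \<in> rmodule_hom R M N. bij_betw f (carrier M) (carrier N))"

definition simple_rmodule ::
    "('a, 'r) ring_scheme \<Rightarrow> ('a, 'm, 'k) rmodule_scheme \<Rightarrow> bool"
  where "simple_rmodule R M \<longleftrightarrow>
    carrier M \<noteq> {\<zero>\<^bsub>M\<^esub>} \<and>
    (\<forall>A. right_submodule A R M \<longrightarrow> A = {\<zero>\<^bsub>M\<^esub>} \<or> A = carrier M)"

definition simple_submodule ::
    "'m set \<Rightarrow> ('a, 'r) ring_scheme \<Rightarrow> ('a, 'm, 'k) rmodule_scheme \<Rightarrow> bool"
  where "simple_submodule A R M \<longleftrightarrow>
    right_submodule A R M \<and> simple_rmodule R (M\<lparr>carrier := A\<rparr>)"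

definition direct_summand ::
    "'m set \<Rightarrow> ('a, 'r) ring_scheme \<Rightarrow> ('a, 'm, 'k) rmodule_scheme \<Rightarrow> bool"
  where "direct_summand A R M \<longleftrightarrow>
    right_submodule A R M \<and>
    (\<exists>C. right_submodule C R M \<and> A <+>\<^bsub>M\<^esub> C = carrier M \<and> A \<inter> C = {\<zero>\<^bsub>M\<^esub>})"

definition maximal_submodule ::
    "'m set \<Rightarrow> ('a, 'r) ring_scheme \<Rightarrow> ('a, 'm, 'k) rmodule_scheme \<Rightarrow> bool"
  where "maximal_submodule A R M \<longleftrightarrow>
    right_submodule A R M \<and> A \<noteq> carrier M \<and>
    (\<forall>C. right_submodule C R M \<longrightarrow> A \<subseteq> C \<longrightarrow> C = A \<or> C = carrier M)"

definition simple_direct_injective ::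
    "('a, 'r) ring_scheme \<Rightarrow> ('a, 'm, 'k) rmodule_scheme \<Rightarrow> bool"
  where "simple_direct_injective R M \<longleftrightarrow>
    (\<forall>A B. simple_submodule A R M \<longrightarrow> simple_submodule B R M \<longrightarrow>
      rmodule_isomorphic R (M\<lparr>carrier := A\<rparr>) (M\<lparr>carrier := B\<rparr>) \<longrightarrow>
      direct_summand B R M \<longrightarrow> direct_summand A R M)"

definition simple_direct_projective ::
    "('a, 'r) ring_scheme \<Rightarrow> ('a, 'm, 'k) rmodule_scheme \<Rightarrow> bool"
  where "simple_direct_projective R M \<longleftrightarrow>
    (\<forall>A B. right_submodule A R M \<longrightarrow> simple_submodule B R M \<longrightarrow>
      rmodule_isomorphic R (quotient_rmodule M A) (M\<lparr>carrier := B\<rparr>) \<longrightarrow>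
      direct_summand B R M \<longrightarrow> direct_summand A R M)"

text \<open>
  HOL cannot quantify over types inside a formula. Hence ``every module'' ranges over the modules
  with carrier contained in a type \<open>'m\<close>, which plays the role of a universe and is passed as
  an argument where it is not determined by the other ones. The carrier type \<open>'m\<close> is meant to be
  left arbitrary in theorems, and is unrelated to the type of ring elements.
\<close>

definition right_max_ring :: "'m itself \<Rightarrow> ('a, 'r) ring_scheme \<Rightarrow> bool"
  where "right_max_ring (_ :: 'm itself) R \<longleftrightarrow>
    ring R \<and>
    (\<forall>M :: ('a, 'm) rmodule. right_module R M \<longrightarrow> carrier M \<noteq> {\<zero>\<^bsub>M\<^esub>} \<longrightarrow>
      (\<exists>A. maximal_submodule A R M))"

end

theory Submission
  imports Defs
begin

text \<open>
  Suppose that \<open>M \<noteq> 0\<close> has no maximal submodule. Let \<open>K\<close> be maximal among the submodules avoiding a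
  fixed \<open>x \<noteq> 0\<close>. Then \<open>N = M / K\<close> has no maximal submodule either, and the class of \<open>x\<close> generates a
  simple submodule \<open>S\<close> of \<open>N\<close>. The only maximal submodule of \<open>P = N \<oplus> S\<close> is \<open>N\<close>, a direct summand, so
  \<open>P\<close> is simple-direct-projective. By assumption it is then simple-direct-injective, so the copy of
  \<open>S\<close> inside \<open>N\<close> has a complement in \<open>P\<close>. This complement is a maximal submodule, hence equal to
  \<open>N\<close>, although it meets \<open>S\<close> trivially.
\<close>

section \<open>Submodules and homomorphisms\<close>

lemma (in right_module) rsmult_zero:
  assumes "x \<in> carrier M"
  shows "x \<cdot>\<^bsub>M\<^esub> \<zero>\<^bsub>R\<^esub> = \<zero>\<^bsub>M\<^esub>"
  using rsmult_add_ring[OF assms R.zero_closed R.zero_closed] assms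
  by (simp add: M.add.l_cancel_one')

lemma (in right_module) rsmult_minus_one:
  assumes "x \<in> carrier M"
  shows "x \<cdot>\<^bsub>M\<^esub> (\<ominus>\<^bsub>R\<^esub> \<one>\<^bsub>R\<^esub>) = \<ominus>\<^bsub>M\<^esub> x"
proof -
  have "x \<cdot>\<^bsub>M\<^esub> (\<ominus>\<^bsub>R\<^esub> \<one>\<^bsub>R\<^esub>) \<oplus>\<^bsub>M\<^esub> x = x \<cdot>\<^bsub>M\<^esub> (\<ominus>\<^bsub>R\<^esub> \<one>\<^bsub>R\<^esub> \<oplus>\<^bsub>R\<^esub> \<one>\<^bsub>R\<^esub>)"
    using assms by (subst rsmult_add_ring) simp_all
  also have "\<dots> = \<zero>\<^bsub>M\<^esub>"
    using assms by (simp add: R.l_neg rsmult_zero)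
  finally show ?thesis
    using assms by (intro M.minus_equality[symmetric]) simp_all
qed

lemma (in right_module) zero_rsmult:
  assumes "a \<in> carrier R"
  shows "\<zero>\<^bsub>M\<^esub> \<cdot>\<^bsub>M\<^esub> a = \<zero>\<^bsub>M\<^esub>"
  using rsmult_add_module[OF M.zero_closed M.zero_closed assms] assms
  by (simp add: M.add.l_cancel_one')

text \<open>Closure under negation comes for free, because \<open>-x\<close> is \<open>x\<close>
  times \<open>-1\<close>. What remains is zero, sums and scalar multiples, and this is the form in
  which submodules are checked from here on.\<close>

lemma (in right_module) right_submodule_iff:
  "right_submodule A R M \<longleftrightarrow>
    A \<subseteq> carrier M \<and> \<zero>\<^bsub>M\<^esub> \<in> A \<and> (\<forall>x\<in>A. \<forall>y\<in>A. x \<oplus>\<^bsub>M\<^esub> y \<in> A) \<and>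
    (\<forall>x\<in>A. \<forall>a\<in>carrier R. x \<cdot>\<^bsub>M\<^esub> a \<in> A)" (is "_ \<longleftrightarrow> ?r")
proof
  assume "right_submodule A R M"
  then interpret right_submodule A R M .
  show ?r
    using a_subset rsmult_mem by auto
next
  assume r: ?r
  have "\<ominus>\<^bsub>M\<^esub> x \<in> A" if "x \<in> A" for x
    using r that rsmult_minus_one[of x] by (metis R.a_inv_closed R.one_closed subsetD)
  then have "subgroup A (add_monoid M)"
    using r by (intro M.add.subgroupI) (auto simp: a_inv_def)
  then show "right_submodule A R M"
    using r by (auto intro!: right_submodule.intro additive_subgroup.intro
        right_submodule_axioms.intro)
qed

lemma (in right_module) right_submodule_minus:
  assumes "right_submodule A R M" "x \<in> A" "y \<in> A"
  shows "x \<ominus>\<^bsub>M\<^esub> y \<in> A"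
proof -
  interpret right_submodule A R M by fact
  show ?thesis using assms by (simp add: a_minus_def)
qed

text \<open>Simplicity of a submodule and maximality inside one speak of the restricted structure;
  this lets both be decided with submodules of \<open>M\<close> alone.\<close>

lemma (in right_module) right_submodule_restrict_iff:
  assumes "right_submodule N R M"
  shows "right_submodule A R (M\<lparr>carrier := N\<rparr>) \<longleftrightarrow> right_submodule A R M \<and> A \<subseteq> N"
proof -
  interpret N: right_module R "M\<lparr>carrier := N\<rparr>"
    using assms by (rule right_submodule_is_right_module)
  show ?thesis
    using assms unfolding N.right_submodule_iff right_submodule_iff by auto
qed

lemma (in right_module) right_submodule_zero: "right_submodule {\<zero>\<^bsub>M\<^esub>} R M"
  unfolding right_submodule_iff by (simp add: zero_rsmult)

section \<open>Sums of submodules and cyclic submodules\<close>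

lemma mem_set_add_iff: "z \<in> A <+>\<^bsub>M\<^esub> B \<longleftrightarrow> (\<exists>x\<in>A. \<exists>y\<in>B. z = x \<oplus>\<^bsub>M\<^esub> y)"
  by (simp add: set_add_def')

lemma set_addI: "x \<in> A \<Longrightarrow> y \<in> B \<Longrightarrow> x \<oplus>\<^bsub>M\<^esub> y \<in> A <+>\<^bsub>M\<^esub> B"
  by (auto simp: mem_set_add_iff)

lemma (in right_module) set_add_commute:
  assumes "A \<subseteq> carrier M" "B \<subseteq> carrier M"
  shows "A <+>\<^bsub>M\<^esub> B = B <+>\<^bsub>M\<^esub> A"
proof -
  have "x \<oplus>\<^bsub>M\<^esub> y = y \<oplus>\<^bsub>M\<^esub> x" if "x \<in> A" "y \<in> B" for x y
    using that assms by (intro M.a_comm) auto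
  then show ?thesis
    unfolding set_eq_iff mem_set_add_iff by metis
qed

lemma (in right_module) subset_set_add:
  assumes "right_submodule A R M" "right_submodule B R M"
  shows "A \<subseteq> A <+>\<^bsub>M\<^esub> B" "B \<subseteq> A <+>\<^bsub>M\<^esub> B"
proof -
  have z: "\<zero>\<^bsub>M\<^esub> \<in> A" "\<zero>\<^bsub>M\<^esub> \<in> B" and sub: "A \<subseteq> carrier M" "B \<subseteq> carrier M"
    using assms by (auto simp: right_submodule_iff)
  have "x \<in> A <+>\<^bsub>M\<^esub> B" if "x \<in> A" for x
    using set_addI[OF that z(2), of M] that sub by (simp add: subsetD)
  then show "A \<subseteq> A <+>\<^bsub>M\<^esub> B" by (rule subsetI)
  have "x \<in> A <+>\<^bsub>M\<^esub> B" if "x \<in> B" for x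
    using set_addI[OF z(1) that, of M] that sub by (simp add: subsetD)
  then show "B \<subseteq> A <+>\<^bsub>M\<^esub> B" by (rule subsetI)
qed

lemma (in right_module) right_submodule_add:
  assumes "right_submodule A R M" "right_submodule B R M"
  shows "right_submodule (A <+>\<^bsub>M\<^esub> B) R M"
  unfolding right_submodule_iff
proof (intro conjI ballI)
  have A: "A \<subseteq> carrier M" "\<And>x y. x \<in> A \<Longrightarrow> y \<in> A \<Longrightarrow> x \<oplus>\<^bsub>M\<^esub> y \<in> A"
      "\<And>x a. x \<in> A \<Longrightarrow> a \<in> carrier R \<Longrightarrow> x \<cdot>\<^bsub>M\<^esub> a \<in> A"
    and B: "B \<subseteq> carrier M" "\<And>x y. x \<in> B \<Longrightarrow> y \<in> B \<Longrightarrow> x \<oplus>\<^bsub>M\<^esub> y \<in> B"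
      "\<And>x a. x \<in> B \<Longrightarrow> a \<in> carrier R \<Longrightarrow> x \<cdot>\<^bsub>M\<^esub> a \<in> B"
    using assms by (auto simp: right_submodule_iff)
  show "A <+>\<^bsub>M\<^esub> B \<subseteq> carrier M"
    using A(1) B(1) by (rule M.set_add_closed)
  show "\<zero>\<^bsub>M\<^esub> \<in> A <+>\<^bsub>M\<^esub> B"
    using subset_set_add(1)[OF assms] assms(1) by (auto simp: right_submodule_iff)
  fix z assume "z \<in> A <+>\<^bsub>M\<^esub> B"
  then obtain x y where xy: "x \<in> A" "y \<in> B" "z = x \<oplus>\<^bsub>M\<^esub> y"
    by (auto simp: mem_set_add_iff)
  have xyM: "x \<in> carrier M" "y \<in> carrier M"
    using xy A(1) B(1) by auto
  show "z \<cdot>\<^bsub>M\<^esub> a \<in> A <+>\<^bsub>M\<^esub> B" if "a \<in> carrier R" for a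
    using set_addI[OF A(3)[OF xy(1) that] B(3)[OF xy(2) that], of M]
    by (simp add: xy(3) rsmult_add_module xyM that)
  fix z' assume "z' \<in> A <+>\<^bsub>M\<^esub> B"
  then obtain x' y' where xy': "x' \<in> A" "y' \<in> B" "z' = x' \<oplus>\<^bsub>M\<^esub> y'"
    by (auto simp: mem_set_add_iff)
  have xyM': "x' \<in> carrier M" "y' \<in> carrier M"
    using xy' A(1) B(1) by auto
  have "z \<oplus>\<^bsub>M\<^esub> z' = (x \<oplus>\<^bsub>M\<^esub> x') \<oplus>\<^bsub>M\<^esub> (y \<oplus>\<^bsub>M\<^esub> y')"
    using xy(3) xy'(3) xyM xyM' by (simp add: M.a_ac)
  then show "z \<oplus>\<^bsub>M\<^esub> z' \<in> A <+>\<^bsub>M\<^esub> B"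
    using set_addI[OF A(2)[OF xy(1) xy'(1)] B(2)[OF xy(2) xy'(2)], of M] by simp
qed

lemma (in right_module) right_submodule_cyclic:
  assumes "s \<in> carrier M"
  shows "right_submodule ((\<lambda>a. s \<cdot>\<^bsub>M\<^esub> a) ` carrier R) R M"
  using assms rsmult_zero[OF assms] unfolding right_submodule_iff
  by (auto simp flip: rsmult_add_ring rsmult_assoc intro: rev_image_eqI[of "\<zero>\<^bsub>R\<^esub>"])

section \<open>Homomorphisms, images and preimages\<close>

lemma rmodule_homD:
  assumes "f \<in> rmodule_hom R M N"
  shows "x \<in> carrier M \<Longrightarrow> f x \<in> carrier N"
    and "x \<in> carrier M \<Longrightarrow> y \<in> carrier M \<Longrightarrow> f (x \<oplus>\<^bsub>M\<^esub> y) = f x \<oplus>\<^bsub>N\<^esub> f y"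
    and "x \<in> carrier M \<Longrightarrow> a \<in> carrier R \<Longrightarrow> f (x \<cdot>\<^bsub>M\<^esub> a) = f x \<cdot>\<^bsub>N\<^esub> a"
  using assms by (auto simp: rmodule_hom_def hom_def)

lemma rmodule_homI:
  assumes "\<And>x. x \<in> carrier M \<Longrightarrow> f x \<in> carrier N"
    and "\<And>x y. x \<in> carrier M \<Longrightarrow> y \<in> carrier M \<Longrightarrow> f (x \<oplus>\<^bsub>M\<^esub> y) = f x \<oplus>\<^bsub>N\<^esub> f y"
    and "\<And>x a. x \<in> carrier M \<Longrightarrow> a \<in> carrier R \<Longrightarrow> f (x \<cdot>\<^bsub>M\<^esub> a) = f x \<cdot>\<^bsub>N\<^esub> a"
  shows "f \<in> rmodule_hom R M N"
  using assms by (auto simp: rmodule_hom_def hom_def)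

locale right_module_hom = M: right_module R M + N: right_module R N
  for R :: "('a, 'r) ring_scheme"
    and M :: "('a, 'm, 'k) rmodule_scheme" and N :: "('a, 'n, 'l) rmodule_scheme" +
  fixes f
  assumes homh: "f \<in> rmodule_hom R M N"
begin

lemmas hom_closed = rmodule_homD(1)[OF homh]
lemmas hom_add = rmodule_homD(2)[OF homh]
lemmas hom_rsmult = rmodule_homD(3)[OF homh]

lemma hom_zero: "f \<zero>\<^bsub>M\<^esub> = \<zero>\<^bsub>N\<^esub>"
  using hom_add[of "\<zero>\<^bsub>M\<^esub>" "\<zero>\<^bsub>M\<^esub>"] hom_closed[of "\<zero>\<^bsub>M\<^esub>"]
  by (simp add: N.M.add.l_cancel_one')

lemma hom_minus:
  assumes "x \<in> carrier M" "y \<in> carrier M"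
  shows "f (x \<ominus>\<^bsub>M\<^esub> y) = f x \<ominus>\<^bsub>N\<^esub> f y"
  using assms hom_rsmult[of y "\<ominus>\<^bsub>R\<^esub> \<one>\<^bsub>R\<^esub>"]
  by (simp add: a_minus_def hom_add hom_closed M.rsmult_minus_one N.rsmult_minus_one)

lemma right_submodule_image:
  assumes "right_submodule A R M"
  shows "right_submodule (f ` A) R N"
proof -
  have A: "A \<subseteq> carrier M" "\<zero>\<^bsub>M\<^esub> \<in> A" "\<And>x y. x \<in> A \<Longrightarrow> y \<in> A \<Longrightarrow> x \<oplus>\<^bsub>M\<^esub> y \<in> A"
    "\<And>x a. x \<in> A \<Longrightarrow> a \<in> carrier R \<Longrightarrow> x \<cdot>\<^bsub>M\<^esub> a \<in> A"
    using assms unfolding M.right_submodule_iff by auto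
  have "\<zero>\<^bsub>N\<^esub> \<in> f ` A"
    using A(2) hom_zero by force
  moreover have "f x \<oplus>\<^bsub>N\<^esub> f y \<in> f ` A" if "x \<in> A" "y \<in> A" for x y
    using A(1) A(3)[OF that] that hom_add[of x y] by (metis imageI subsetD)
  moreover have "f x \<cdot>\<^bsub>N\<^esub> a \<in> f ` A" if "x \<in> A" "a \<in> carrier R" for x a
    using A(1) A(4)[OF that] that hom_rsmult[of x a] by (metis imageI subsetD)
  ultimately show ?thesis
    using A(1) hom_closed unfolding N.right_submodule_iff by auto
qed

lemma right_submodule_vimage:
  assumes "right_submodule A R N"
  shows "right_submodule {x \<in> carrier M. f x \<in> A} R M"
  using assms unfolding M.right_submodule_iff N.right_submodule_iff
  by (auto simp: hom_zero hom_add hom_rsmult)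

text \<open>A submodule containing the kernel is the preimage of its image.\<close>

lemma maximal_submodule_vimage:
  assumes surj: "f ` carrier M = carrier N" and A: "maximal_submodule A R N"
  shows "maximal_submodule {x \<in> carrier M. f x \<in> A} R M"
proof -
  have sA: "right_submodule A R N" and neq: "A \<noteq> carrier N"
    using A by (auto simp: maximal_submodule_def)
  have Asub: "A \<subseteq> carrier N" and zA: "\<zero>\<^bsub>N\<^esub> \<in> A"
    using sA by (auto simp: N.right_submodule_iff)
  have "C = {x \<in> carrier M. f x \<in> A} \<or> C = carrier M"
    if C: "right_submodule C R M" and sub: "{x \<in> carrier M. f x \<in> A} \<subseteq> C" for C
  proof -
    have Cc: "C \<subseteq> carrier M"
      using C by (auto simp: M.right_submodule_iff)
    \<comment> \<open>Since \<open>A\<close> contains zero, \<open>C\<close> contains the kernel of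
      \<open>f\<close>. Two elements with the same image differ by a kernel element, so membership
      in \<open>C\<close> depends only on the image.\<close>
    have ker: "x \<in> C" if "x \<in> carrier M" and fx: "f x \<in> f ` C" for x
    proof -
      obtain y where y: "y \<in> C" "f x = f y"
        using fx by blast
      have yM: "y \<in> carrier M"
        using y Cc by auto
      have "f (x \<ominus>\<^bsub>M\<^esub> y) = \<zero>\<^bsub>N\<^esub>"
        using N.M.r_neg[OF hom_closed[OF yM]]
        unfolding hom_minus[OF that(1) yM] y(2) a_minus_def[of N] .
      moreover have "x \<ominus>\<^bsub>M\<^esub> y \<in> carrier M"
        using that yM by simp
      ultimately have "x \<ominus>\<^bsub>M\<^esub> y \<in> C"
        using sub zA by auto
      then have "(x \<ominus>\<^bsub>M\<^esub> y) \<oplus>\<^bsub>M\<^esub> y \<in> C"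
        using y C by (auto simp: M.right_submodule_iff)
      moreover have "(x \<ominus>\<^bsub>M\<^esub> y) \<oplus>\<^bsub>M\<^esub> y = x"
        using that yM by (simp add: a_minus_def M.M.a_assoc M.M.l_neg)
      ultimately show ?thesis by simp
    qed
    have "y \<in> f ` C" if "y \<in> A" for y
    proof -
      have "y \<in> f ` carrier M"
        using that Asub surj by (simp add: subset_iff)
      then obtain x where x: "x \<in> carrier M" "y = f x"
        by (rule imageE) simp
      then have "x \<in> C"
        using sub that by (simp add: subset_iff)
      then show ?thesis
        unfolding x(2) by (rule imageI)
    qed
    then have "A \<subseteq> f ` C" ..
    then have "f ` C = A \<or> f ` C = carrier N"
      using A right_submodule_image[OF C] by (auto simp: maximal_submodule_def)
    then show ?thesis
    proof
      assume "f ` C = A"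
      then have "C = {x \<in> carrier M. f x \<in> A}"
        using ker Cc by auto
      then show ?thesis ..
    next
      assume "f ` C = carrier N"
      then have "C = carrier M"
        using ker Cc hom_closed by auto
      then show ?thesis ..
    qed
  qed
  moreover have "{x \<in> carrier M. f x \<in> A} \<noteq> carrier M"
  proof
    assume "{x \<in> carrier M. f x \<in> A} = carrier M"
    then have "f ` carrier M \<subseteq> A" by auto
    then show False
      using neq Asub surj by simp
  qed
  ultimately show ?thesis
    using right_submodule_vimage[OF sA] by (auto simp: maximal_submodule_def)
qed

text \<open>A submodule of the image is the image of its own preimage, and simplicity makes that
  preimage zero or everything. Injectivity only has to keep the image from collapsing to
  zero.\<close>

lemma simple_submodule_image:
  assumes inj: "inj_on f (carrier M)" and simple: "simple_rmodule R M"
  shows "simple_submodule (f ` carrier M) R N"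
proof -
  have sub: "right_submodule (f ` carrier M) R N"
    by (rule right_submodule_image) (auto simp: M.right_submodule_iff)
  have "D = {\<zero>\<^bsub>N\<^esub>} \<or> D = f ` carrier M"
    if D: "right_submodule D R N" "D \<subseteq> f ` carrier M" for D
  proof -
    define E where "E = {x \<in> carrier M. f x \<in> D}"
    have "right_submodule E R M"
      using right_submodule_vimage[OF D(1)] by (simp add: E_def)
    moreover have "D = f ` E"
      using D(2) by (auto simp: E_def)
    ultimately show ?thesis
      using simple hom_zero by (auto simp: simple_rmodule_def)
  qed
  moreover have "f ` carrier M \<noteq> {\<zero>\<^bsub>N\<^esub>}"
  proof
    assume *: "f ` carrier M = {\<zero>\<^bsub>N\<^esub>}"
    have "x = \<zero>\<^bsub>M\<^esub>" if "x \<in> carrier M" for x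
    proof -
      have "f x = f \<zero>\<^bsub>M\<^esub>"
        using * that hom_zero by auto
      then show ?thesis
        using inj that by (auto dest: inj_onD)
    qed
    then show False
      using simple by (auto simp: simple_rmodule_def)
  qed
  ultimately show ?thesis
    using sub by (auto simp: simple_submodule_def simple_rmodule_def
        N.right_submodule_restrict_iff)
qed

end

text \<open>Cutting the codomain down to the image makes \<open>f\<close> surjective, so that
  maximal submodules of an embedded copy of \<open>M\<close> can be pulled back to
  \<open>M\<close>.\<close>

lemma right_module_hom_restrict_image:
  assumes "right_module_hom R M N f"
  shows "right_module_hom R M (N\<lparr>carrier := f ` carrier M\<rparr>) f"
proof -
  interpret right_module_hom R M N f by fact
  have "right_submodule (f ` carrier M) R N"
    by (rule right_submodule_image) (auto simp: M.right_submodule_iff)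
  then show ?thesis
    by (intro right_module_hom.intro M.right_module_axioms
        N.right_submodule_is_right_module right_module_hom_axioms.intro rmodule_homI)
      (auto simp: hom_add hom_rsmult)
qed

lemma right_module_hom_comp:
  assumes "right_module_hom R M N f" "right_module_hom R N P g"
  shows "right_module_hom R M P (g \<circ> f)"
proof -
  interpret f: right_module_hom R M N f by fact
  interpret g: right_module_hom R N P g by fact
  show ?thesis
    by (intro right_module_hom.intro f.M.right_module_axioms g.N.right_module_axioms
        right_module_hom_axioms.intro rmodule_homI)
      (auto simp: f.hom_closed g.hom_closed f.hom_add g.hom_add f.hom_rsmult g.hom_rsmult)
qed

text \<open>Two embeddings of one module have isomorphic images: go back along \<open>f\<close>,
  then forward along \<open>g\<close>. This will relate the two copies of \<open>S\<close> in
  \<open>P\<close>.\<close>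

lemma rmodule_isomorphic_images:
  assumes "right_module_hom R M N f" "inj_on f (carrier M)"
    and "right_module_hom R M N g" "inj_on g (carrier M)"
  shows "rmodule_isomorphic R (N\<lparr>carrier := f ` carrier M\<rparr>) (N\<lparr>carrier := g ` carrier M\<rparr>)"
proof -
  interpret f: right_module_hom R M N f by fact
  interpret g: right_module_hom R M N g by fact
  define k where "k = g \<circ> inv_into (carrier M) f"
  have k: "k (f x) = g x" if "x \<in> carrier M" for x
    using that assms(2) by (simp add: k_def)
  have "k \<in> rmodule_hom R (N\<lparr>carrier := f ` carrier M\<rparr>) (N\<lparr>carrier := g ` carrier M\<rparr>)"
    \<comment> \<open>The homomorphism laws of \<open>f\<close> are applied from right to left: a
      sum or multiple of elements \<open>f x\<close> must again have the form \<open>f z\<close>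
      before \<open>k\<close> can be evaluated on it.\<close>
    by (rule rmodule_homI)
      (auto simp: k g.hom_add g.hom_rsmult simp flip: f.hom_add f.hom_rsmult)
  moreover have "bij_betw k (f ` carrier M) (g ` carrier M)"
  proof (rule bij_betw_imageI)
    show "inj_on k (f ` carrier M)"
      using assms(4) by (auto simp: inj_on_def k)
    show "k ` f ` carrier M = g ` carrier M"
      by (force simp: k)
  qed
  ultimately show ?thesis
    unfolding rmodule_isomorphic_def by auto
qed

section \<open>Maximal submodules\<close>

lemma (in right_module) maximal_submodule_zero:
  assumes "simple_rmodule R M"
  shows "maximal_submodule {\<zero>\<^bsub>M\<^esub>} R M"
  using assms right_submodule_zero by (auto simp: maximal_submodule_def simple_rmodule_def)

text \<open>The finite family of proper submodules contains the zero submodule, hence has a maximal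
  element. The use is the contrapositive: a nonzero module without maximal submodules is
  infinite.\<close>

lemma (in right_module) maximal_submodule_finite:
  assumes fin: "finite (carrier M)" and "carrier M \<noteq> {\<zero>\<^bsub>M\<^esub>}"
  shows "\<exists>A. maximal_submodule A R M"
proof -
  let ?F = "{A. right_submodule A R M \<and> A \<noteq> carrier M}"
  have "?F \<subseteq> Pow (carrier M)"
    by (auto simp: right_submodule_iff)
  then have "finite ?F"
    using fin by (meson finite_Pow_iff finite_subset)
  moreover have "{\<zero>\<^bsub>M\<^esub>} \<in> ?F"
    using assms right_submodule_zero by auto
  ultimately obtain A where "A \<in> ?F" "\<forall>B\<in>?F. A \<subseteq> B \<longrightarrow> A = B"
    by (metis (no_types, lifting) empty_iff finite_has_maximal)
  then show ?thesis
    unfolding maximal_submodule_def by blast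
qed

text \<open>The quotient by \<open>C\<close> is a copy of the simple module \<open>T\<close>. In
  elements: a submodule \<open>D\<close> above \<open>C\<close> meets \<open>T\<close> in
  \<open>T\<close> or in zero. In the first case \<open>D\<close> contains the whole sum, in the
  second it is \<open>C\<close>.\<close>

lemma (in right_module) maximal_submodule_complement:
  assumes T: "simple_submodule T R M" and C: "right_submodule C R M"
    and sum: "T <+>\<^bsub>M\<^esub> C = carrier M" and int: "T \<inter> C = {\<zero>\<^bsub>M\<^esub>}"
  shows "maximal_submodule C R M"
proof -
  have sT: "right_submodule T R M" and nz: "T \<noteq> {\<zero>\<^bsub>M\<^esub>}"
    using T by (auto simp: simple_submodule_def simple_rmodule_def)
  have Tsub: "T \<subseteq> carrier M" and Csub: "C \<subseteq> carrier M"
    using sT C by (auto simp: right_submodule_iff)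
  have "D = C \<or> D = carrier M" if D: "right_submodule D R M" and CD: "C \<subseteq> D" for D
  proof -
    have Dsub: "D \<subseteq> carrier M"
      using D by (auto simp: right_submodule_iff)
    have "right_submodule (D \<inter> T) R M"
      using D sT by (auto simp: right_submodule_iff)
    then have "D \<inter> T = {\<zero>\<^bsub>M\<^esub>} \<or> D \<inter> T = T"
      using T by (auto simp: simple_submodule_def simple_rmodule_def right_submodule_restrict_iff)
    then show ?thesis
    proof
      assume "D \<inter> T = T"
      then have "t \<oplus>\<^bsub>M\<^esub> c \<in> D" if "t \<in> T" "c \<in> C" for t c
        using D CD that unfolding right_submodule_iff by blast
      then have "T <+>\<^bsub>M\<^esub> C \<subseteq> D"
        by (auto simp: mem_set_add_iff)
      then show ?thesis
        using sum Dsub by auto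
    next
      assume z: "D \<inter> T = {\<zero>\<^bsub>M\<^esub>}"
      have "d \<in> C" if d: "d \<in> D" for d
      proof -
        have "d \<in> T <+>\<^bsub>M\<^esub> C"
          using d Dsub sum by auto
        then obtain t c where tc: "t \<in> T" "c \<in> C" "d = t \<oplus>\<^bsub>M\<^esub> c"
          by (auto simp: mem_set_add_iff)
        then have "t \<in> carrier M" "c \<in> carrier M"
          using Tsub Csub by auto
        \<comment> \<open>Because \<open>C\<close> lies in \<open>D\<close>, the component
          \<open>t\<close> of \<open>d\<close> lies in \<open>D\<close> as well, hence in the zero
          intersection with \<open>T\<close>, and \<open>d\<close> equals \<open>c\<close>.\<close>
        then have "d \<ominus>\<^bsub>M\<^esub> c = t"
          by (simp add: tc(3) a_minus_def M.a_assoc M.r_neg)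
        then have "t \<in> D \<inter> T"
          using right_submodule_minus[OF D d, of c] tc CD by auto
        then show ?thesis
          using z tc Csub by auto
      qed
      then show ?thesis
        using CD by auto
    qed
  qed
  moreover have "C \<noteq> carrier M"
    using int Tsub nz by auto
  ultimately show ?thesis
    using C by (auto simp: maximal_submodule_def)
qed

text \<open>As \<open>N\<close> is not inside \<open>C\<close>, the sum of \<open>C\<close> and
  \<open>N\<close> is \<open>M\<close>, and \<open>N\<close> modulo the intersection is isomorphic
  to \<open>M\<close> modulo \<open>C\<close>. The argument below is direct: for \<open>D\<close>
  between the intersection and \<open>N\<close>, maximality of \<open>C\<close> makes
  \<open>D + C\<close> equal to \<open>C\<close> or to \<open>M\<close>.\<close>

lemma (in right_module) maximal_submodule_Int:
  assumes C: "maximal_submodule C R M" and N: "right_submodule N R M" and nsub: "\<not> N \<subseteq> C"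
  shows "maximal_submodule (C \<inter> N) R (M\<lparr>carrier := N\<rparr>)"
proof -
  have sC: "right_submodule C R M"
    using C by (auto simp: maximal_submodule_def)
  have Csub: "C \<subseteq> carrier M" and Nsub: "N \<subseteq> carrier M"
    using sC N by (auto simp: right_submodule_iff)
  have "D = C \<inter> N \<or> D = N"
    if D: "right_submodule D R M" "D \<subseteq> N" and sub: "C \<inter> N \<subseteq> D" for D
  proof -
    note DC = subset_set_add[OF D(1) sC]
    consider "D <+>\<^bsub>M\<^esub> C = C" | "D <+>\<^bsub>M\<^esub> C = carrier M"
      using C DC right_submodule_add[OF D(1) sC] by (auto simp: maximal_submodule_def)
    then show ?thesis
    proof cases
      case 1
      then show ?thesis using DC D sub by auto
    next
      case 2
      have "n \<in> D" if n: "n \<in> N" for n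
      proof -
        have "n \<in> D <+>\<^bsub>M\<^esub> C"
          using n Nsub 2 by auto
        then obtain d c where dc: "d \<in> D" "c \<in> C" "n = d \<oplus>\<^bsub>M\<^esub> c"
          by (auto simp: mem_set_add_iff)
        then have "d \<in> carrier M" "c \<in> carrier M"
          using Csub D Nsub by auto
        \<comment> \<open>Here the modular law is at work: \<open>c\<close> is a difference of
          elements of \<open>N\<close>, so it lies in both \<open>C\<close> and \<open>N\<close> and
          therefore in \<open>D\<close>.\<close>
        then have "n \<ominus>\<^bsub>M\<^esub> d = c"
          by (simp add: dc(3) a_minus_def M.a_ac M.r_neg)
        then have "c \<in> D"
          using right_submodule_minus[OF N n, of d] dc D sub by auto
        then show ?thesis
          using dc D by (auto simp: right_submodule_iff)
      qed
      then show ?thesis using D by auto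
    qed
  qed
  moreover have "right_submodule (C \<inter> N) R M"
    using sC N by (auto simp: right_submodule_iff)
  ultimately show ?thesis
    using nsub by (auto simp: maximal_submodule_def right_submodule_restrict_iff[OF N])
qed

section \<open>Quotient maps, and a submodule without maximal submodules\<close>

lemma (in right_module) quotient_hom:
  assumes "right_submodule A R M"
  shows "right_module_hom R M (quotient_rmodule M A) (\<lambda>x. A +>\<^bsub>M\<^esub> x)"
    and "(\<lambda>x. A +>\<^bsub>M\<^esub> x) ` carrier M = carrier (quotient_rmodule M A)"
    and "x \<in> carrier M \<Longrightarrow> A +>\<^bsub>M\<^esub> x = \<zero>\<^bsub>quotient_rmodule M A\<^esub> \<longleftrightarrow> x \<in> A"
proof -
  interpret A: right_submodule A R M by fact
  interpret A: abelian_subgroup A M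
    by (rule abelian_subgroupI3[OF A.additive_subgroup_axioms M.abelian_group_axioms])
  show "(\<lambda>x. A +>\<^bsub>M\<^esub> x) ` carrier M = carrier (quotient_rmodule M A)"
    by (auto simp: quotient_rmodule_def A_RCOSETS_def')
  moreover have add: "A +>\<^bsub>M\<^esub> (x \<oplus>\<^bsub>M\<^esub> y) = (A +>\<^bsub>M\<^esub> x) \<oplus>\<^bsub>quotient_rmodule M A\<^esub> (A +>\<^bsub>M\<^esub> y)"
    if "x \<in> carrier M" "y \<in> carrier M" for x y
    using that by (simp add: quotient_rmodule_def A.a_rcos_sum)
  ultimately show "right_module_hom R M (quotient_rmodule M A) (\<lambda>x. A +>\<^bsub>M\<^esub> x)"
    by (intro right_module_hom.intro right_module_axioms quotient_is_right_module[OF assms]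
        right_module_hom_axioms.intro rmodule_homI)
      (auto simp: quotient_rsmult_coset[OF assms] add)
  show "A +>\<^bsub>M\<^esub> x = \<zero>\<^bsub>quotient_rmodule M A\<^esub> \<longleftrightarrow> x \<in> A" if "x \<in> carrier M"
  proof
    assume "A +>\<^bsub>M\<^esub> x = \<zero>\<^bsub>quotient_rmodule M A\<^esub>"
    then show "x \<in> A"
      using A.a_rcos_self[OF that] by (simp add: quotient_rmodule_def)
  next
    assume "x \<in> A"
    then show "A +>\<^bsub>M\<^esub> x = \<zero>\<^bsub>quotient_rmodule M A\<^esub>"
      by (simp add: quotient_rmodule_def A.a_rcos_const)
  qed
qed

text \<open>\<open>A\<close> is the kernel of the surjection from \<open>M\<close> through the
  quotient onto \<open>B\<close>, that is, the preimage of the zero submodule, which is maximal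
  because \<open>B\<close> is simple.\<close>

lemma (in right_module) maximal_submodule_kernel:
  assumes A: "right_submodule A R M" and B: "right_module R B" "simple_rmodule R B"
    and iso: "rmodule_isomorphic R (quotient_rmodule M A) B"
  shows "maximal_submodule A R M"
proof -
  let ?Q = "quotient_rmodule M A" and ?p = "\<lambda>x. A +>\<^bsub>M\<^esub> x"
  interpret Q: right_module R ?Q
    using A by (rule quotient_is_right_module)
  interpret B: right_module R B by fact
  obtain g where g: "g \<in> rmodule_hom R ?Q B" "bij_betw g (carrier ?Q) (carrier B)"
    using iso unfolding rmodule_isomorphic_def by auto
  interpret g: right_module_hom R ?Q B g
    by unfold_locales (fact g(1))
  interpret gp: right_module_hom R M B "g \<circ> ?p"
    using quotient_hom(1)[OF A] g.right_module_hom_axioms by (rule right_module_hom_comp)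
  have "(g \<circ> ?p) ` carrier M = carrier B"
    unfolding image_comp[symmetric] quotient_hom(2)[OF A] using g(2) by (rule bij_betw_imp_surj_on)
  then have "maximal_submodule {x \<in> carrier M. (g \<circ> ?p) x \<in> {\<zero>\<^bsub>B\<^esub>}} R M"
    by (rule gp.maximal_submodule_vimage) (rule B.maximal_submodule_zero[OF B(2)])
  moreover have "g (?p x) = \<zero>\<^bsub>B\<^esub> \<longleftrightarrow> x \<in> A" if "x \<in> carrier M" for x
  proof -
    have "?p x \<in> carrier ?Q"
      using that quotient_hom(2)[OF A] by auto
    then have "g (?p x) = g \<zero>\<^bsub>?Q\<^esub> \<longleftrightarrow> ?p x = \<zero>\<^bsub>?Q\<^esub>"
      using g(2) by (auto simp: bij_betw_def inj_on_eq_iff)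
    then show ?thesis
      using quotient_hom(3)[OF A that] by (simp add: g.hom_zero)
  qed
  moreover have "A \<subseteq> carrier M"
    using A by (auto simp: right_submodule_iff)
  ultimately show ?thesis
    by (simp cong: conj_cong add: Collect_conj_eq Int_absorb1)
qed

text \<open>Every maximal submodule contains \<open>N\<close>, since otherwise it would cut out a
  maximal submodule of \<open>N\<close>. But \<open>N\<close> is itself maximal, being a complement
  of the simple \<open>S\<close>. So \<open>N\<close> is the only candidate for a submodule with
  simple quotient, and it is a direct summand.\<close>

lemma (in right_module) simple_direct_projective_if_no_maximal:
  assumes N: "right_submodule N R M" and S: "simple_submodule S R M"
    and sum: "S <+>\<^bsub>M\<^esub> N = carrier M" and int: "S \<inter> N = {\<zero>\<^bsub>M\<^esub>}"
    and nomax: "\<nexists>A. maximal_submodule A R (M\<lparr>carrier := N\<rparr>)"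
  shows "simple_direct_projective R M"
  unfolding simple_direct_projective_def
proof (intro allI impI)
  fix A B
  assume A: "right_submodule A R M" and B: "simple_submodule B R M"
    and iso: "rmodule_isomorphic R (quotient_rmodule M A) (M\<lparr>carrier := B\<rparr>)"
  have "maximal_submodule A R M"
    using A B iso
    by (intro maximal_submodule_kernel[of _ "M\<lparr>carrier := B\<rparr>"])
      (auto simp: simple_submodule_def right_submodule_is_right_module)
  moreover from this have "N \<subseteq> A"
    using maximal_submodule_Int[OF _ N] nomax by blast
  moreover have "maximal_submodule N R M"
    using S N sum int by (rule maximal_submodule_complement)
  ultimately have "A = N"
    by (auto simp: maximal_submodule_def)
  moreover have "N <+>\<^bsub>M\<^esub> S = S <+>\<^bsub>M\<^esub> N"
    using N S set_add_commute by (auto simp: simple_submodule_def right_submodule_iff)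
  ultimately show "direct_summand A R M"
    using N S sum int by (auto simp: direct_summand_def simple_submodule_def)
qed

text \<open>A complement of \<open>T\<close> would be maximal and so contain \<open>N\<close>, which
  contains \<open>T\<close>. The trivial intersection would then force \<open>T\<close> to be
  zero.\<close>

lemma (in right_module) not_direct_summand_if_no_maximal:
  assumes N: "right_submodule N R M" and T: "simple_submodule T R M" "T \<subseteq> N"
    and nomax: "\<nexists>A. maximal_submodule A R (M\<lparr>carrier := N\<rparr>)"
  shows "\<not> direct_summand T R M"
proof
  assume "direct_summand T R M"
  then obtain C where C: "right_submodule C R M" "T <+>\<^bsub>M\<^esub> C = carrier M" "T \<inter> C = {\<zero>\<^bsub>M\<^esub>}"
    by (auto simp: direct_summand_def)
  then have "maximal_submodule C R M"
    using T(1) by (intro maximal_submodule_complement)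
  then have "N \<subseteq> C"
    using maximal_submodule_Int[OF _ N] nomax by blast
  then show False
    using T C by (auto simp: simple_submodule_def simple_rmodule_def)
qed

section \<open>Direct products and transport of structure\<close>

definition prod_rmodule ::
    "('a, 'm, 'k) rmodule_scheme \<Rightarrow> ('a, 'n, 'l) rmodule_scheme \<Rightarrow> ('a, 'm \<times> 'n) rmodule"
  where "prod_rmodule M N =
    \<lparr>carrier = carrier M \<times> carrier N, mult = undefined, one = undefined,
     zero = (\<zero>\<^bsub>M\<^esub>, \<zero>\<^bsub>N\<^esub>), add = (\<lambda>(x, y) (x', y'). (x \<oplus>\<^bsub>M\<^esub> x', y \<oplus>\<^bsub>N\<^esub> y')),
     rsmult = (\<lambda>(x, y) a. (x \<cdot>\<^bsub>M\<^esub> a, y \<cdot>\<^bsub>N\<^esub> a))\<rparr>"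

lemma prod_rmodule_simps [simp]:
  "carrier (prod_rmodule M N) = carrier M \<times> carrier N"
  "\<zero>\<^bsub>prod_rmodule M N\<^esub> = (\<zero>\<^bsub>M\<^esub>, \<zero>\<^bsub>N\<^esub>)"
  "(x, y) \<oplus>\<^bsub>prod_rmodule M N\<^esub> (x', y') = (x \<oplus>\<^bsub>M\<^esub> x', y \<oplus>\<^bsub>N\<^esub> y')"
  "(x, y) \<cdot>\<^bsub>prod_rmodule M N\<^esub> a = (x \<cdot>\<^bsub>M\<^esub> a, y \<cdot>\<^bsub>N\<^esub> a)"
  by (simp_all add: prod_rmodule_def)

lemma right_module_prod:
  assumes "right_module R M" "right_module R N"
  shows "right_module R (prod_rmodule M N)"
proof -
  interpret M: right_module R M by fact
  interpret N: right_module R N by fact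
  have "abelian_group (prod_rmodule M N)"
  proof (rule abelian_groupI)
    fix p assume "p \<in> carrier (prod_rmodule M N)"
    then show "\<exists>q\<in>carrier (prod_rmodule M N). q \<oplus>\<^bsub>prod_rmodule M N\<^esub> p = \<zero>\<^bsub>prod_rmodule M N\<^esub>"
      by (intro bexI[of _ "(\<ominus>\<^bsub>M\<^esub> fst p, \<ominus>\<^bsub>N\<^esub> snd p)"]) (auto simp: M.M.l_neg N.M.l_neg)
  qed (auto simp: M.M.a_ac N.M.a_ac)
  then show ?thesis
    by (intro right_module.intro right_module_axioms.intro M.R.ring_axioms)
      (auto simp: M.rsmult_add_ring N.rsmult_add_ring M.rsmult_add_module N.rsmult_add_module
        M.rsmult_assoc N.rsmult_assoc)
qed

text \<open>When \<open>h\<close> is injective on the carrier, this is the structure on its image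
  that makes \<open>h\<close> an isomorphism. It moves a direct sum, whose elements are pairs, into
  a prescribed carrier type.\<close>

definition transport_rmodule ::
    "('m \<Rightarrow> 'n) \<Rightarrow> ('a, 'm, 'k) rmodule_scheme \<Rightarrow> ('a, 'n) rmodule"
  where "transport_rmodule h M = (let g = inv_into (carrier M) h in
    \<lparr>carrier = h ` carrier M, mult = undefined, one = undefined,
     zero = h \<zero>\<^bsub>M\<^esub>, add = (\<lambda>x y. h (g x \<oplus>\<^bsub>M\<^esub> g y)), rsmult = (\<lambda>x a. h (g x \<cdot>\<^bsub>M\<^esub> a))\<rparr>)"

lemma transport_rmodule_simps:
  assumes "inj_on h (carrier M)"
  shows "carrier (transport_rmodule h M) = h ` carrier M"
    and "\<zero>\<^bsub>transport_rmodule h M\<^esub> = h \<zero>\<^bsub>M\<^esub>"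
    and "x \<in> carrier M \<Longrightarrow> y \<in> carrier M \<Longrightarrow> h x \<oplus>\<^bsub>transport_rmodule h M\<^esub> h y = h (x \<oplus>\<^bsub>M\<^esub> y)"
    and "x \<in> carrier M \<Longrightarrow> h x \<cdot>\<^bsub>transport_rmodule h M\<^esub> a = h (x \<cdot>\<^bsub>M\<^esub> a)"
  using assms by (simp_all add: transport_rmodule_def Let_def)

lemma right_module_transport:
  assumes "right_module R M" and inj: "inj_on h (carrier M)"
  shows "right_module R (transport_rmodule h M)"
proof -
  interpret M: right_module R M by fact
  note simps = transport_rmodule_simps[OF inj]
  have "abelian_group (transport_rmodule h M)"
  proof (rule abelian_groupI)
    fix p assume "p \<in> carrier (transport_rmodule h M)"
    then obtain x where "x \<in> carrier M" "p = h x"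
      by (auto simp: simps)
    then show "\<exists>q\<in>carrier (transport_rmodule h M).
        q \<oplus>\<^bsub>transport_rmodule h M\<^esub> p = \<zero>\<^bsub>transport_rmodule h M\<^esub>"
      by (intro bexI[of _ "h (\<ominus>\<^bsub>M\<^esub> x)"]) (auto simp: simps M.M.l_neg)
  qed (auto simp: simps M.M.a_ac)
  then show ?thesis
    by (intro right_module.intro right_module_axioms.intro M.R.ring_axioms)
      (auto simp: simps M.rsmult_add_ring M.rsmult_add_module M.rsmult_assoc)
qed

lemma right_module_hom_transport:
  assumes "right_module R M" "inj_on h (carrier M)"
  shows "right_module_hom R M (transport_rmodule h M) h"
  using assms
  by (intro right_module_hom.intro right_module_transport right_module_hom_axioms.intro
      rmodule_homI) (auto simp: transport_rmodule_simps)

section \<open>The module without maximal submodules\<close>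

text \<open>The witness is the direct sum of \<open>M\<close> and \<open>S\<close>, transported
  along \<open>h\<close>. Simple-direct-injectivity fails at the two copies of \<open>S\<close>: the
  one from the second factor is a summand, the isomorphic one inside the copy of \<open>M\<close> is
  not. The map \<open>h\<close> leaves the choice of the target type to the caller.\<close>

lemma (in right_module) no_maximal_witness:
  fixes h :: "'m \<times> 'm \<Rightarrow> 'p"
  assumes S: "simple_submodule S R M" and nomax: "\<nexists>A. maximal_submodule A R M"
    and inj: "inj_on h (carrier M \<times> S)"
  obtains P :: "('a, 'p) rmodule"
  where "right_module R P" "simple_direct_projective R P" "\<not> simple_direct_injective R P"
proof -
  let ?S = "M\<lparr>carrier := S\<rparr>"
  have sS: "right_submodule S R M" and simS: "simple_rmodule R ?S"
    using S by (auto simp: simple_submodule_def)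
  interpret S: right_module R ?S
    using sS by (rule right_submodule_is_right_module)
  have Ssub: "S \<subseteq> carrier M" and zS: "\<zero>\<^bsub>M\<^esub> \<in> S"
    using sS by (auto simp: right_submodule_iff)
  define Q where "Q = prod_rmodule M ?S"
  interpret Q: right_module R Q
    unfolding Q_def using right_module_axioms S.right_module_axioms by (rule right_module_prod)
  have carQ: "carrier Q = carrier M \<times> S"
    by (simp add: Q_def)
  define P where "P = transport_rmodule h Q"
  have injQ: "inj_on h (carrier Q)"
    using inj by (simp add: carQ)
  interpret h: right_module_hom R Q P h
    unfolding P_def using Q.right_module_axioms injQ by (rule right_module_hom_transport)
  have h_add: "h (x, s) \<oplus>\<^bsub>P\<^esub> h (x', s') = h (x \<oplus>\<^bsub>M\<^esub> x', s \<oplus>\<^bsub>M\<^esub> s')"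
    if "x \<in> carrier M" "s \<in> S" "x' \<in> carrier M" "s' \<in> S" for x s x' s'
    using h.hom_add[of "(x, s)" "(x', s')"] that unfolding carQ by (simp add: Q_def)
  have h_rsmult: "h (x, s) \<cdot>\<^bsub>P\<^esub> a = h (x \<cdot>\<^bsub>M\<^esub> a, s \<cdot>\<^bsub>M\<^esub> a)"
    if "x \<in> carrier M" "s \<in> S" "a \<in> carrier R" for x s a
    using h.hom_rsmult[of "(x, s)" a] that unfolding carQ by (simp add: Q_def)
  have h_closed: "h (x, s) \<in> carrier P" if "x \<in> carrier M" "s \<in> S" for x s
    using h.hom_closed[of "(x, s)"] that by (simp add: carQ)
  have h_eq: "h (x, s) = h (x', s') \<longleftrightarrow> x = x' \<and> s = s'"
    if "x \<in> carrier M" "s \<in> S" "x' \<in> carrier M" "s' \<in> S" for x s x' s'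
    using inj_on_eq_iff[OF inj, of "(x, s)" "(x', s')"] that by simp
  have zP: "\<zero>\<^bsub>P\<^esub> = h (\<zero>\<^bsub>M\<^esub>, \<zero>\<^bsub>M\<^esub>)"
    using h.hom_zero by (simp add: Q_def)
  have carP: "carrier P = h ` (carrier M \<times> S)"
    using transport_rmodule_simps(1)[OF injQ] by (simp add: P_def carQ)
  \<comment> \<open>These are the two coordinate embeddings into \<open>P\<close>. The image of
    \<open>M\<close> under \<open>i\<close> will act as \<open>N\<close>, the image of
    \<open>S\<close> under \<open>j\<close> as its simple complement, and the image of
    \<open>S\<close> under \<open>i\<close> as the submodule that is no summand.\<close>
  define i where "i = (\<lambda>x. h (x, \<zero>\<^bsub>M\<^esub>))"
  define j where "j = (\<lambda>s. h (\<zero>\<^bsub>M\<^esub>, s))"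
  note SM = subsetD[OF Ssub]
  have "i \<in> rmodule_hom R M P"
    by (rule rmodule_homI) (simp_all add: i_def zS h_closed h_add h_rsmult zero_rsmult)
  then have i: "right_module_hom R M P i"
    by unfold_locales
  have "i \<in> rmodule_hom R ?S P"
    by (rule rmodule_homI) (simp_all add: i_def zS SM h_closed h_add h_rsmult zero_rsmult)
  then have iS: "right_module_hom R ?S P i"
    by unfold_locales
  have "j \<in> rmodule_hom R ?S P"
    by (rule rmodule_homI) (simp_all add: j_def zS h_closed h_add h_rsmult zero_rsmult)
  then have jS: "right_module_hom R ?S P j"
    by unfold_locales
  have inj_iS: "inj_on i (carrier ?S)"
    by (rule inj_onI) (simp add: i_def zS SM h_eq)
  have inj_jS: "inj_on j (carrier ?S)"
    by (rule inj_onI) (simp add: j_def zS h_eq)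
  interpret i: right_module_hom R M P i by (fact i)
  interpret i': right_module_hom R M "P\<lparr>carrier := i ` carrier M\<rparr>" i
    by (rule right_module_hom_restrict_image) (fact i)
  interpret iS: right_module_hom R ?S P i by (fact iS)
  interpret jS: right_module_hom R ?S P j by (fact jS)
  have N: "right_submodule (i ` carrier M) R P"
    by (rule i.right_submodule_image) (auto simp: right_submodule_iff)
  \<comment> \<open>A maximal submodule of the copy would pull back along the surjection
    \<open>i\<close> to one of \<open>M\<close>.\<close>
  have nomaxN: "\<nexists>A. maximal_submodule A R (P\<lparr>carrier := i ` carrier M\<rparr>)"
    using i'.maximal_submodule_vimage nomax by auto
  have T: "simple_submodule (i ` S) R P"
    using iS.simple_submodule_image[OF inj_iS simS] by simp
  have J: "simple_submodule (j ` S) R P"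
    using jS.simple_submodule_image[OF inj_jS simS] by simp
  have sum: "j ` S <+>\<^bsub>P\<^esub> i ` carrier M = carrier P"
  proof
    show "j ` S <+>\<^bsub>P\<^esub> i ` carrier M \<subseteq> carrier P"
      using J N by (intro h.N.M.set_add_closed)
        (simp_all add: simple_submodule_def h.N.right_submodule_iff)
    have "h (x, s) \<in> j ` S <+>\<^bsub>P\<^esub> i ` carrier M" if "x \<in> carrier M" "s \<in> S" for x s
    proof -
      have "j s \<oplus>\<^bsub>P\<^esub> i x = h (x, s)"
        using that by (simp add: j_def i_def zS SM h_add)
      then show ?thesis
        using that set_addI[of "j s" "j ` S" "i x" "i ` carrier M" P] by simp
    qed
    then show "carrier P \<subseteq> j ` S <+>\<^bsub>P\<^esub> i ` carrier M"
      unfolding carP by (intro image_subsetI) auto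
  qed
  have int: "j ` S \<inter> i ` carrier M = {\<zero>\<^bsub>P\<^esub>}"
  proof
    show "j ` S \<inter> i ` carrier M \<subseteq> {\<zero>\<^bsub>P\<^esub>}"
      by (clarsimp simp: i_def j_def zS h_eq zP)
    show "{\<zero>\<^bsub>P\<^esub>} \<subseteq> j ` S \<inter> i ` carrier M"
      using zS unfolding i_def j_def zP by blast
  qed
  have "simple_direct_projective R P"
    using h.N.simple_direct_projective_if_no_maximal[OF N J sum int nomaxN] .
  moreover have "direct_summand (j ` S) R P"
    using J N sum int by (auto simp: direct_summand_def simple_submodule_def)
  moreover have "\<not> direct_summand (i ` S) R P"
    using Ssub by (intro h.N.not_direct_summand_if_no_maximal[OF N T _ nomaxN]) auto
  moreover have "rmodule_isomorphic R (P\<lparr>carrier := i ` S\<rparr>) (P\<lparr>carrier := j ` S\<rparr>)"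
    using rmodule_isomorphic_images[OF iS inj_iS jS inj_jS] by simp
  ultimately show thesis
    using T J h.N.right_module_axioms by (intro that) (auto simp: simple_direct_injective_def)
qed

text \<open>This is Zorn's lemma, started at the zero submodule. Modulo such a \<open>K\<close>, the
  class of \<open>x\<close> lies in every nonzero submodule.\<close>

lemma (in right_module) ex_maximal_submodule_avoiding:
  assumes "x \<in> carrier M" "x \<noteq> \<zero>\<^bsub>M\<^esub>"
  obtains K where "right_submodule K R M" "x \<notin> K"
    and "\<And>C. right_submodule C R M \<Longrightarrow> K \<subset> C \<Longrightarrow> x \<in> C"
proof -
  let ?F = "{A. right_submodule A R M \<and> x \<notin> A}"
  have "\<exists>K\<in>?F. \<forall>X\<in>?F. K \<subseteq> X \<longrightarrow> X = K"
  proof (rule subset_Zorn_nonempty)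
    show "?F \<noteq> {}"
      using right_submodule_zero assms by auto
    fix \<C> assume ne: "\<C> \<noteq> {}" and chain: "subset.chain ?F \<C>"
    then have sub: "right_submodule A R M" "x \<notin> A" if "A \<in> \<C>" for A
      using that by (auto simp: subset.chain_def)
    have mem: "A \<subseteq> carrier M" "\<zero>\<^bsub>M\<^esub> \<in> A"
      "\<And>a b. a \<in> A \<Longrightarrow> b \<in> A \<Longrightarrow> a \<oplus>\<^bsub>M\<^esub> b \<in> A"
      "\<And>a r. a \<in> A \<Longrightarrow> r \<in> carrier R \<Longrightarrow> a \<cdot>\<^bsub>M\<^esub> r \<in> A"
      if "A \<in> \<C>" for A
      using sub(1)[OF that] by (auto simp: right_submodule_iff)
    \<comment> \<open>The union bounds the chain: a member exists and supplies zero, and of two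
      members one contains the other, so any two elements can be added inside a single
      member.\<close>
    have "right_submodule (\<Union>\<C>) R M"
      unfolding right_submodule_iff
    proof (intro conjI ballI)
      show "\<Union>\<C> \<subseteq> carrier M"
        using mem(1) by (rule Union_least)
      show "\<zero>\<^bsub>M\<^esub> \<in> \<Union>\<C>"
        using ne mem(2) by (meson UnionI ex_in_conv)
      fix a assume "a \<in> \<Union>\<C>"
      then obtain A where A: "A \<in> \<C>" "a \<in> A" ..
      show "a \<cdot>\<^bsub>M\<^esub> r \<in> \<Union>\<C>" if "r \<in> carrier R" for r
        using A(1) mem(4)[OF A that] by (rule UnionI)
      fix b assume "b \<in> \<Union>\<C>"
      then obtain B where B: "B \<in> \<C>" "b \<in> B" ..
      have "A \<subseteq> B \<or> B \<subseteq> A"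
        using A(1) B(1) chain by (auto simp: subset_chain_def)
      then show "a \<oplus>\<^bsub>M\<^esub> b \<in> \<Union>\<C>"
      proof
        assume "A \<subseteq> B"
        then show ?thesis
          using A(2) B mem(3)[OF B(1), of a b] by auto
      next
        assume "B \<subseteq> A"
        then show ?thesis
          using B(2) A mem(3)[OF A(1), of a b] by auto
      qed
    qed
    then show "\<Union>\<C> \<in> ?F"
      using sub(2) by auto
  qed
  then show thesis
    using that by blast
qed

text \<open>A nonzero submodule of the cyclic module contains its generator \<open>s\<close>, hence
  all of it. By \<open>least\<close>, this cyclic module even lies in every nonzero submodule of
  \<open>M\<close>.\<close>

lemma (in right_module) simple_submodule_cyclic:
  assumes s: "s \<in> carrier M" "s \<noteq> \<zero>\<^bsub>M\<^esub>"
    and least: "\<And>D. right_submodule D R M \<Longrightarrow> D \<noteq> {\<zero>\<^bsub>M\<^esub>} \<Longrightarrow> s \<in> D"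
  shows "simple_submodule ((\<lambda>a. s \<cdot>\<^bsub>M\<^esub> a) ` carrier R) R M"
proof -
  let ?S = "(\<lambda>a. s \<cdot>\<^bsub>M\<^esub> a) ` carrier R"
  have S: "right_submodule ?S R M"
    using s(1) by (rule right_submodule_cyclic)
  have "s \<in> ?S"
    using s(1) by (intro rev_image_eqI[of "\<one>\<^bsub>R\<^esub>"]) auto
  moreover have "?S \<subseteq> D" if "right_submodule D R M" "D \<noteq> {\<zero>\<^bsub>M\<^esub>}" for D
    using least[OF that] that(1) by (auto simp: right_submodule_iff)
  ultimately show ?thesis
    using S s(2) by (auto simp: simple_submodule_def simple_rmodule_def
        right_submodule_restrict_iff[OF S])
qed

theorem proposition8:
  fixes R :: "('a, 'r) ring_scheme"
  assumes "ring R"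
    and "\<And>M :: ('a, 'm) rmodule. right_module R M \<Longrightarrow> simple_direct_projective R M \<Longrightarrow>
      simple_direct_injective R M"
  shows "right_max_ring TYPE('m) R"
  unfolding right_max_ring_def
proof (intro conjI allI impI assms(1))
  fix M :: "('a, 'm) rmodule"
  assume "right_module R M" and nz: "carrier M \<noteq> {\<zero>\<^bsub>M\<^esub>}"
  interpret right_module R M by fact
  show "\<exists>A. maximal_submodule A R M"
  proof (rule ccontr)
    assume nomax: "\<nexists>A. maximal_submodule A R M"
    obtain x where x: "x \<in> carrier M" "x \<noteq> \<zero>\<^bsub>M\<^esub>"
      using nz M.zero_closed by blast
    obtain K where K: "right_submodule K R M" "x \<notin> K"
      and Kmax: "\<And>C. right_submodule C R M \<Longrightarrow> K \<subset> C \<Longrightarrow> x \<in> C"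
      using ex_maximal_submodule_avoiding[OF x] by blast
    let ?Q = "quotient_rmodule M K" and ?p = "\<lambda>y. K +>\<^bsub>M\<^esub> y"
    interpret p: right_module_hom R M ?Q ?p
      using K(1) by (rule quotient_hom)
    note surj = quotient_hom(2)[OF K(1)] and ker = quotient_hom(3)[OF K(1)]
    have nomaxQ: "\<nexists>A. maximal_submodule A R ?Q"
      using p.maximal_submodule_vimage[OF surj] nomax by auto
    have least: "?p x \<in> D" if D: "right_submodule D R ?Q" "D \<noteq> {\<zero>\<^bsub>?Q\<^esub>}" for D
    proof -
      \<comment> \<open>The preimage of \<open>D\<close> contains the kernel \<open>K\<close>, and
        strictly so: a nonzero class in \<open>D\<close> has a representative outside
        \<open>K\<close>. The choice of \<open>K\<close> then puts \<open>x\<close> into the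
        preimage.\<close>
      let ?C = "{y \<in> carrier M. ?p y \<in> D}"
      have zD: "\<zero>\<^bsub>?Q\<^esub> \<in> D" and "D \<subseteq> ?p ` carrier M"
        using D(1) surj by (auto simp: p.N.right_submodule_iff)
      then obtain y where y: "y \<in> carrier M" "?p y \<in> D" "?p y \<noteq> \<zero>\<^bsub>?Q\<^esub>"
        using D(2) by blast
      have "K \<subseteq> ?C"
      proof
        fix z assume "z \<in> K"
        moreover from this have "z \<in> carrier M"
          using K(1) by (auto simp: right_submodule_iff)
        ultimately show "z \<in> ?C"
          using ker[of z] zD by simp
      qed
      moreover have "y \<in> ?C - K"
        using y ker by auto
      ultimately have "x \<in> ?C"
        by (intro Kmax p.right_submodule_vimage[OF D(1)]) auto
      then show ?thesis by simp
    qed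
    let ?S = "(\<lambda>a. ?p x \<cdot>\<^bsub>?Q\<^esub> a) ` carrier R"
    have S: "simple_submodule ?S R ?Q"
      using p.hom_closed[OF x(1)] ker[OF x(1)] K(2) least
      by (intro p.N.simple_submodule_cyclic) auto
    then have Ssub: "?S \<subseteq> carrier ?Q"
      by (auto simp: simple_submodule_def p.N.right_submodule_iff)
    text \<open>
      Since \<open>M\<close> is infinite, the square of its cardinality is no larger, so the direct sum
      of \<open>M / K\<close> and its submodule \<open>S\<close> fits into the universe \<open>'m\<close>.
    \<close>
    have "infinite (carrier M)"
      using maximal_submodule_finite nz nomax by blast
    then obtain k where k: "bij_betw k (carrier M \<times> carrier M) (carrier M)"
      using card_of_Times_same_infinite by (auto simp flip: card_of_ordIso)
    \<comment> \<open>\<open>r\<close> picks a representative in \<open>M\<close> for each coset,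
      and applying \<open>?p\<close> recovers the coset. A pair of cosets becomes a pair of elements
      of \<open>M\<close>, which \<open>k\<close> encodes as one element of type
      \<open>'m\<close>.\<close>
    define r where "r = inv_into (carrier M) ?p"
    have r: "inj_on r (carrier ?Q)" "r ` carrier ?Q \<subseteq> carrier M"
      unfolding r_def surj[symmetric] by (auto intro: inj_on_inv_into inv_into_into)
    have "inj_on (k \<circ> map_prod r r) (carrier ?Q \<times> ?S)"
    proof (rule comp_inj_on)
      show "inj_on (map_prod r r) (carrier ?Q \<times> ?S)"
        using r(1) Ssub by (intro map_prod_inj_on) (auto intro: inj_on_subset)
      show "inj_on k (map_prod r r ` (carrier ?Q \<times> ?S))"
        using bij_betw_imp_inj_on[OF k] r(2) Ssub by (elim inj_on_subset) auto
    qed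
    \<comment> \<open>The encoding places the witness in type \<open>'m\<close>, where the
      assumption on simple-direct-projective modules applies and is contradicted.\<close>
    then show False
      by (rule p.N.no_maximal_witness[OF S nomaxQ]) (use assms(2) in simp)
  qed
qed

end
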